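(* Let $X$ be a path-connected ANR space, $n\ge 1$ and $m\ge 2$ integers. Let $\pi_m:RP(\mathcal B_n(X))\to(\mathcal B_n(X))^m$ be the evaluation map $\pi_m(\phi)=(\phi(t_1),\dots,\phi(t_m))$ with $t_i=(i-1)/(m-1)$, let $\omega_n^m:X^m\to(\mathcal B_n(X))^m$ be $\omega_n^m(x_1,\dots,x_m)=(\delta_{x_1},\dots,\delta_{x_m})$, and let $q_m:\mathcal U_{n,m}\to X^m$ be the pullback of $\pi_m$ along $\omega_n^m$. Then $\mathsf{iTC}_m(X)<n$ if and only if there exists a (continuous) section of the map $q_m:\mathcal U_{n,m}\to X^m$.
   Context: $I=[0,1]$. For a metric space $Z$ and $n\ge 1$, $\mathcal B_n(Z)$ is the space of probability measures on $Z$ whose support has at most $n$ points, written as finite formal convex combinations $\sum\lambda_z z$ with $\lambda_z>0$, $\sum\lambda_z=1$, equipped with the Lévy–Prokhorov metric; $\delta_z$ is the Dirac measure at $z$. $P(Z)$ is the space of continuous paths $I\to Z$ with the compact-open topology. Define $\Phi_n:\mathcal B_n(P(X))\to P(\mathcal B_n(X))$ by $\Phi_n(\sum\lambda_\alpha\alpha)(t)=\sum\lambda_\alpha\alpha(t)$. A path $f\in P(\mathcal B_n(X))$ is resolvable if $f=\Phi_n(\mu)$ for some $\mu\in\mathcal B_n(P(X))$; $RP(\mathcal B_n(X))\subset P(\mathcal B_n(X))$ is the subspace of resolvable paths. $\mathsf{iTC}_m(X)$ is the minimal integer $n\ge 0$ such that there is a continuous map $s_m:X^m\to RP(\mathcal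 B_{n+1}(X))$ with $s_m(x_1,\dots,x_m)(t_i)=\delta_{x_i}$ for all $1\le i\le m$ and all $(x_1,\dots,x_m)\in X^m$ (infinite if no such $n$ exists). *)

theory Defs
  imports "HOL-Probability.Probability"
begin

subsection \<open>Absolute neighbourhood retracts for metrizable spaces\<close>

text \<open>
  The library constant \<^const>\<open>ANR\<close> only tests closed copies of a set in one product type and is meant for
  subsets of Euclidean spaces, so the general notion is defined here: a metrizable space is an ANR
  if each of its closed copies in a metrizable space is a retract of a neighbourhood.

  HOL cannot quantify over all types, so the ambient spaces \<open>Y\<close> are the metrizable
  spaces with points in \<^typ>\<open>'a \<Rightarrow> real\<close>. This loses nothing: with a bounded compatible metric on \<open>X\<close>,
  the Kuratowski map embeds \<open>X\<close> as a closed subset of the convex hull of its image in the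
  Banach space of bounded functions on \<open>X\<close> (Wojdyslawski), and that convex hull is among the tested \<open>Y\<close>.
  By Dugundji's theorem, being a neighbourhood retract there implies being one in every
  metrizable space, of any type, that contains \<open>X\<close> as a closed subset.
\<close>

definition ANR_space :: "'a topology \<Rightarrow> bool" where
  "ANR_space X \<longleftrightarrow>
     metrizable_space X \<and>
     (\<forall>(Y :: ('a \<Rightarrow> real) topology) S.
        metrizable_space Y \<and> closedin Y S \<and> X homeomorphic_space subtopology Y S \<longrightarrow>
        (\<exists>U. openin Y U \<and> S \<subseteq> U \<and> S retract_of_space subtopology Y U))"

subsection \<open>Finitely supported probability measures and the Levy--Prokhorov metric\<close>

text \<open>
  A formal convex combination $\sum \lambda_z z$ is the probability mass function with weight
  $\lambda_z$ at \<open>z\<close>; the Dirac measure at \<open>z\<close> is \<^term>\<open>return_pmf z\<close>.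
\<close>

definition fin_prob :: "nat \<Rightarrow> 'a set \<Rightarrow> 'a pmf set" where
  "fin_prob n Z = {p. set_pmf p \<subseteq> Z \<and> finite (set_pmf p) \<and> card (set_pmf p) \<le> n}"

definition borel_sets_of :: "'a topology \<Rightarrow> 'a set set" where
  "borel_sets_of X = sigma_sets (topspace X) {U. openin X U}"

definition thickening :: "'a metric \<Rightarrow> real \<Rightarrow> 'a set \<Rightarrow> 'a set" where
  "thickening X e A = {y \<in> mspace X. \<exists>a\<in>A. mdist X a y < e}"

definition levy_prokhorov :: "'a metric \<Rightarrow> 'a pmf \<Rightarrow> 'a pmf \<Rightarrow> real" where
  "levy_prokhorov X p q =
     Inf {e. 0 < e \<and>
             (\<forall>A \<in> borel_sets_of (mtopology_of X).
                measure_pmf.prob p A \<le> measure_pmf.prob q (thickening X e A) + e \<and>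
                measure_pmf.prob q A \<le> measure_pmf.prob p (thickening X e A) + e)}"

definition fin_prob_metric :: "nat \<Rightarrow> 'a metric \<Rightarrow> 'a pmf metric" where
  "fin_prob_metric n X = metric (fin_prob n (mspace X), levy_prokhorov X)"

abbreviation fin_prob_space :: "nat \<Rightarrow> 'a metric \<Rightarrow> 'a pmf topology" where
  "fin_prob_space n X \<equiv> mtopology_of (fin_prob_metric n X)"

text \<open>
  The following shows that \<^const>\<open>fin_prob_metric\<close> applies the abstraction function \<^const>\<open>metric\<close>
  to a genuine metric.
\<close>

lemma openin_thickening:
  assumes "A \<subseteq> mspace X"
  shows "openin (mtopology_of X) (thickening X e A)"
proof -
  have "thickening X e A = (\<Union>a\<in>A. mball_of X a e)"
    using assms by (fastforce simp: thickening_def)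
  moreover have "openin (mtopology_of X) (mball_of X a e)" for a
    by (simp add: mball_of_def mtopology_of_def Metric_space.openin_mball)
  ultimately show ?thesis by auto
qed

lemma borel_sets_of_subset: "A \<in> borel_sets_of X \<Longrightarrow> A \<subseteq> topspace X"
  unfolding borel_sets_of_def
  by (rule sigma_sets_into_sp) (auto dest: openin_subset)

lemma thickening_in_borel:
  "A \<in> borel_sets_of (mtopology_of X) \<Longrightarrow> thickening X e A \<in> borel_sets_of (mtopology_of X)"
  using borel_sets_of_subset[of A "mtopology_of X"] openin_thickening[of A X e]
  by (auto simp: borel_sets_of_def)

lemma singleton_in_borel:
  assumes "x \<in> mspace X" shows "{x} \<in> borel_sets_of (mtopology_of X)"
proof -
  have "closedin (mtopology_of X) {x}"
    using assms by (simp add: mtopology_of_def closedin_Hausdorff_singleton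
        Metric_space.Hausdorff_space_mtopology Metric_space.topspace_mtopology)
  then have "openin (mtopology_of X) (topspace (mtopology_of X) - {x})"
    by blast
  then have "topspace (mtopology_of X) - (topspace (mtopology_of X) - {x}) \<in> borel_sets_of (mtopology_of X)"
    unfolding borel_sets_of_def by (intro sigma_sets.Compl sigma_sets.Basic) auto
  moreover have "topspace (mtopology_of X) - (topspace (mtopology_of X) - {x}) = {x}"
    using assms by auto
  ultimately show ?thesis by simp
qed

lemma Metric_space_levy_prokhorov: "Metric_space (fin_prob n (mspace X)) (levy_prokhorov X)"
proof
  define E where "E p q = {e. 0 < e \<and>
             (\<forall>A \<in> borel_sets_of (mtopology_of X).
                measure_pmf.prob p A \<le> measure_pmf.prob q (thickening X e A) + e \<and>
                measure_pmf.prob q A \<le> measure_pmf.prob p (thickening X e A) + e)}" for p q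
  have LP: "levy_prokhorov X p q = Inf (E p q)" for p q
    by (simp add: levy_prokhorov_def E_def)
  have one: "1 \<in> E p q" for p q
    by (auto simp: E_def intro!: order_trans[OF measure_pmf.prob_le_1])
  have bdd: "bdd_below (E p q)" for p q
    by (rule bdd_belowI[of _ 0]) (auto simp: E_def)
  have le: "levy_prokhorov X p q \<le> e" if "e \<in> E p q" for p q e
    unfolding LP using that bdd by (rule cInf_lower)
  have close: "\<exists>e \<in> E p q. e < c" if "levy_prokhorov X p q < c" for p q c
    using that one[of p q] unfolding LP by (subst (asm) cInf_less_iff) (use bdd in auto)
  fix p q r :: "'a pmf"
  show nonneg: "0 \<le> levy_prokhorov X p q"
    unfolding LP by (rule cInf_greatest) (use one[of p q] in blast, simp add: E_def)
  have "E p q = E q p"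
    by (auto simp: E_def)
  then show "levy_prokhorov X p q = levy_prokhorov X q p"
    by (simp add: LP)
  assume p: "p \<in> fin_prob n (mspace X)" and q: "q \<in> fin_prob n (mspace X)"
  show "levy_prokhorov X p q = 0 \<longleftrightarrow> p = q"
  proof
    assume "p = q"
    have "e \<in> E p q" if "e > 0" for e
    proof -
      have "measure_pmf.prob p A \<le> measure_pmf.prob p (thickening X e A) + e"
        if A: "A \<in> borel_sets_of (mtopology_of X)" for A
      proof -
        have "A \<subseteq> thickening X e A"
        proof
          fix a assume "a \<in> A"
          moreover from this have "a \<in> mspace X" using borel_sets_of_subset[OF A] by auto
          moreover from this have "mdist X a a = 0" by simp
          ultimately show "a \<in> thickening X e A"
            using \<open>e > 0\<close> unfolding thickening_def by (metis (mono_tags, lifting) mem_Collect_eq)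
        qed
        then have "measure_pmf.prob p A \<le> measure_pmf.prob p (thickening X e A)"
          by (intro measure_pmf.finite_measure_mono) auto
        with \<open>e > 0\<close> show ?thesis by simp
      qed
      with \<open>p = q\<close> \<open>e > 0\<close> show ?thesis by (auto simp: E_def)
    qed
    then have "levy_prokhorov X p q \<le> 0 + e" if "e > 0" for e
      using le that by simp
    then have "levy_prokhorov X p q \<le> 0"
      by (rule field_le_epsilon)
    with nonneg show "levy_prokhorov X p q = 0" by simp
  next
    assume 0: "levy_prokhorov X p q = 0"
    have key: "pmf a x \<le> pmf b x"
      if lp: "levy_prokhorov X a b = 0" and a: "a \<in> fin_prob n (mspace X)"
        and b: "b \<in> fin_prob n (mspace X)" for a b x
    proof (cases "x \<in> set_pmf a")
      case False
      then show ?thesis by (simp add: set_pmf_iff)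
    next
      case True
      then have x: "x \<in> mspace X" using a by (auto simp: fin_prob_def)
      define D where "D = mdist X x ` (set_pmf b - {x})"
      have fin: "finite D" using b by (simp add: D_def fin_prob_def)
      have pos: "0 < d" if "d \<in> D" for d
        using that b x unfolding D_def fin_prob_def
        by (auto simp: order.strict_iff_order)
      define c where "c = Min (insert 1 D)"
      have c: "c > 0" "\<And>d. d \<in> D \<Longrightarrow> c \<le> d"
        using fin pos by (auto simp: c_def)
      show ?thesis
      proof (rule field_le_epsilon)
        fix e :: real assume "e > 0"
        then obtain e' where e': "e' \<in> E a b" "e' < min e c"
          using close[of a b "min e c"] lp c(1) by auto
        have "pmf a x = measure_pmf.prob a {x}"
          by (simp add: measure_pmf_single)
        also have "\<dots> \<le> measure_pmf.prob b (thickening X e' {x}) + e'"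
          using e'(1) singleton_in_borel[OF x] by (auto simp: E_def)
        also have "measure_pmf.prob b (thickening X e' {x})
            = measure_pmf.prob b (thickening X e' {x} \<inter> set_pmf b)"
          by (simp add: measure_Int_set_pmf)
        also have "\<dots> \<le> measure_pmf.prob b {x}"
        proof (rule measure_pmf.finite_measure_mono)
          show "thickening X e' {x} \<inter> set_pmf b \<subseteq> {x}"
            using e'(2) c(2) by (force simp: thickening_def D_def)
        qed auto
        finally show "pmf a x \<le> pmf b x + e"
          using e'(2) by (simp add: measure_pmf_single)
      qed
    qed
    have zero': "levy_prokhorov X q p = 0"
      using 0 \<open>E p q = E q p\<close> by (simp add: LP)
    show "p = q"
      using key[OF 0 p q] key[OF zero' q p] by (intro pmf_eqI antisym)
  qed
  assume r: "r \<in> fin_prob n (mspace X)"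
  have add: "e + f \<in> E p r" if e: "e \<in> E p q" and f: "f \<in> E q r" for e f
  proof -
    have sub: "thickening X e1 (thickening X e2 A) \<subseteq> thickening X (e + f) A"
      if A: "A \<in> borel_sets_of (mtopology_of X)" and ef: "e1 + e2 = e + f" for A e1 e2
    proof
      fix y assume "y \<in> thickening X e1 (thickening X e2 A)"
      then obtain z a where z: "y \<in> mspace X" "z \<in> mspace X" "a \<in> A" "mdist X a z < e2" "mdist X z y < e1"
        by (auto simp: thickening_def)
      moreover have "a \<in> mspace X" using borel_sets_of_subset[OF A] z by auto
      ultimately have "mdist X a y < e + f"
        using mdist_triangle[of a X z y] ef by linarith
      with z show "y \<in> thickening X (e + f) A" by (auto simp: thickening_def)
    qed
    have "measure_pmf.prob p A \<le> measure_pmf.prob r (thickening X (e + f) A) + (e + f) \<and>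
          measure_pmf.prob r A \<le> measure_pmf.prob p (thickening X (e + f) A) + (e + f)"
      if A: "A \<in> borel_sets_of (mtopology_of X)" for A
    proof -
      have "measure_pmf.prob p A \<le> measure_pmf.prob q (thickening X e A) + e"
        using e A by (auto simp: E_def)
      also have "measure_pmf.prob q (thickening X e A)
          \<le> measure_pmf.prob r (thickening X f (thickening X e A)) + f"
        using f thickening_in_borel[OF A] by (auto simp: E_def)
      also have "measure_pmf.prob r (thickening X f (thickening X e A))
          \<le> measure_pmf.prob r (thickening X (e + f) A)"
        by (intro measure_pmf.finite_measure_mono sub A) auto
      finally have 1: "measure_pmf.prob p A \<le> measure_pmf.prob r (thickening X (e + f) A) + (e + f)"
        by simp
      have "measure_pmf.prob r A \<le> measure_pmf.prob q (thickening X f A) + f"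
        using f A by (auto simp: E_def)
      also have "measure_pmf.prob q (thickening X f A)
          \<le> measure_pmf.prob p (thickening X e (thickening X f A)) + e"
        using e thickening_in_borel[OF A] by (auto simp: E_def)
      also have "measure_pmf.prob p (thickening X e (thickening X f A))
          \<le> measure_pmf.prob p (thickening X (e + f) A)"
        by (intro measure_pmf.finite_measure_mono sub A) auto
      finally show ?thesis using 1 by simp
    qed
    moreover have "0 < e + f" using e f by (simp add: E_def)
    ultimately show ?thesis by (simp add: E_def)
  qed
  show "levy_prokhorov X p r \<le> levy_prokhorov X p q + levy_prokhorov X q r"
  proof (rule field_le_epsilon)
    fix c :: real assume "c > 0"
    then obtain e f where "e \<in> E p q" "e < levy_prokhorov X p q + c/2"
      and "f \<in> E q r" "f < levy_prokhorov X q r + c/2"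
      using close[of p q "levy_prokhorov X p q + c/2"] close[of q r "levy_prokhorov X q r + c/2"] by auto
    with le[OF add, of e f] show
      "levy_prokhorov X p r \<le> levy_prokhorov X p q + levy_prokhorov X q r + c"
      by linarith
  qed
qed

lemma mspace_fin_prob_metric: "mspace (fin_prob_metric n X) = fin_prob n (mspace X)"
  by (simp add: fin_prob_metric_def Metric_space.mspace_metric[OF Metric_space_levy_prokhorov])

lemma mdist_fin_prob_metric: "mdist (fin_prob_metric n X) = levy_prokhorov X"
  by (simp add: fin_prob_metric_def Metric_space.mdist_metric[OF Metric_space_levy_prokhorov])

subsection \<open>Path spaces and resolvable paths\<close>

abbreviation unit_interval :: "real topology" where
  "unit_interval \<equiv> top_of_set {0..1}"

text \<open>
  Paths are extensional functions on $[0,1]$, so that distinct elements of the path space are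
  distinct as maps $[0,1] \to Z$.
\<close>

definition paths :: "'a topology \<Rightarrow> (real \<Rightarrow> 'a) set" where
  "paths Z = {f \<in> extensional {0..1}. continuous_map unit_interval Z f}"

text \<open>The underlying set of the topology below is \<^term>\<open>paths Z\<close>, by taking \<open>K\<close> empty.\<close>

definition path_space :: "'a topology \<Rightarrow> (real \<Rightarrow> 'a) topology" where
  "path_space Z = topology_generated_by
     {{f \<in> paths Z. f ` K \<subseteq> U} | K U. compactin unit_interval K \<and> openin Z U}"

lemma topspace_path_space: "topspace (path_space Z) = paths Z"
proof
  show "topspace (path_space Z) \<subseteq> paths Z"
    by (auto simp: path_space_def)
  have "paths Z = {f \<in> paths Z. f ` {} \<subseteq> topspace Z}" by simp
  then have "openin (path_space Z) (paths Z)"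
    unfolding path_space_def by (intro topology_generated_by_Basis) blast
  then show "paths Z \<subseteq> topspace (path_space Z)"
    by (rule openin_subset)
qed

definition Phi :: "(real \<Rightarrow> 'a) pmf \<Rightarrow> real \<Rightarrow> 'a pmf" where
  "Phi \<mu> = restrict (\<lambda>t. map_pmf (\<lambda>\<alpha>. \<alpha> t) \<mu>) {0..1}"

text \<open>
  Resolvability only involves the points of $\mathcal B_n(P(X))$, so no metric on $P(X)$ has to
  be chosen.
\<close>

definition resolvable :: "nat \<Rightarrow> 'a metric \<Rightarrow> (real \<Rightarrow> 'a pmf) \<Rightarrow> bool" where
  "resolvable n X f \<longleftrightarrow>
     f \<in> paths (fin_prob_space n X) \<and> (\<exists>\<mu> \<in> fin_prob n (paths (mtopology_of X)). f = Phi \<mu>)"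

definition resolvable_path_space :: "nat \<Rightarrow> 'a metric \<Rightarrow> (real \<Rightarrow> 'a pmf) topology" where
  "resolvable_path_space n X = subtopology (path_space (fin_prob_space n X)) {f. resolvable n X f}"

subsection \<open>The sequential intertwining topological complexity\<close>

text \<open>The power $Z^m$; tuples are indexed by $1,\dots,m$.\<close>

abbreviation topology_power :: "'a topology \<Rightarrow> nat \<Rightarrow> (nat \<Rightarrow> 'a) topology" where
  "topology_power Z m \<equiv> product_topology (\<lambda>_. Z) {1..m}"

definition time_point :: "nat \<Rightarrow> nat \<Rightarrow> real" where
  "time_point m i = (real i - 1) / (real m - 1)"

definition iTC :: "nat \<Rightarrow> 'a metric \<Rightarrow> enat" where
  "iTC m X = Inf {enat n | n.
     \<exists>s. continuous_map (topology_power (mtopology_of X) m) (resolvable_path_space (n + 1) X) s \<and>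
         (\<forall>x \<in> topspace (topology_power (mtopology_of X) m).
            \<forall>i \<in> {1..m}. s x (time_point m i) = return_pmf (x i))}"

subsection \<open>The pullback of the evaluation map\<close>

definition eval_map :: "nat \<Rightarrow> (real \<Rightarrow> 'b) \<Rightarrow> nat \<Rightarrow> 'b" where
  "eval_map m \<phi> = restrict (\<lambda>i. \<phi> (time_point m i)) {1..m}"

definition dirac_map :: "nat \<Rightarrow> (nat \<Rightarrow> 'a) \<Rightarrow> nat \<Rightarrow> 'a pmf" where
  "dirac_map m x = restrict (\<lambda>i. return_pmf (x i)) {1..m}"

definition fibre_product :: "'a topology \<Rightarrow> 'b topology \<Rightarrow> ('a \<Rightarrow> 'c) \<Rightarrow> ('b \<Rightarrow> 'c) \<Rightarrow> ('a \<times> 'b) topology" where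
  "fibre_product A B f g = subtopology (prod_topology A B) {(a, b). f a = g b}"

definition U_space :: "nat \<Rightarrow> nat \<Rightarrow> 'a metric \<Rightarrow> ((nat \<Rightarrow> 'a) \<times> (real \<Rightarrow> 'a pmf)) topology" where
  "U_space n m X = fibre_product (topology_power (mtopology_of X) m) (resolvable_path_space n X)
                     (dirac_map m) (eval_map m)"

definition q_map :: "(nat \<Rightarrow> 'a) \<times> (real \<Rightarrow> 'a pmf) \<Rightarrow> nat \<Rightarrow> 'a" where
  "q_map = fst"

end

theory Submission
  imports Defs
begin

text \<open>
  Write \<open>RP\<^sub>n\<close> for the space of resolvable paths in measures with at most \<open>n\<close> support points.
  A section of a pullback carries the same data as a lift: the first component of a section of
  $q_m$ is forced to be the identity, and its second component is a continuous map
  $s : X^m \to RP_n$ with $\pi_m \circ s = \omega_n^m$, that is, with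
  $s(x_1,\dots,x_m)(t_i) = \delta_{x_i}$ (lemma \<open>section_fibre_product_iff_lift\<close>). This is exactly
  the map that the definition of \<open>iTC\<close> asks for at the index \<open>n - 1\<close>.

  What remains is that an infimum below \<open>n\<close> only provides such a map into $RP_k$ for some
  \<open>k \<le> n\<close>. It can be regarded as a map into $RP_n$ because the inclusion $RP_k \to RP_n$ is
  continuous (lemma \<open>continuous_map_resolvable_path_space_mono\<close>): the Levy--Prokhorov distance
  of two measures does not refer to the bound on their supports, so measures with at most \<open>k\<close>
  support points form a topological subspace of those with at most \<open>n\<close>, and enlarging the
  target space of paths is continuous for the compact-open topology.
\<close>

lemma fin_prob_mono: "k \<le> n \<Longrightarrow> fin_prob k Z \<subseteq> fin_prob n Z"
  by (auto simp: fin_prob_def)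

lemma fin_prob_space_eq_subtopology:
  assumes "k \<le> n"
  shows "fin_prob_space k X = subtopology (fin_prob_space n X) (fin_prob k (mspace X))"
proof -
  have "submetric (fin_prob_metric n X) (fin_prob k (mspace X)) = fin_prob_metric k X"
    using fin_prob_mono[OF assms, of "mspace X"]
    by (simp add: submetric_def mspace_fin_prob_metric mdist_fin_prob_metric
        fin_prob_metric_def[of k] Int_absorb1 Int_absorb2)
  then show ?thesis
    by (metis mtopology_of_submetric)
qed

lemma paths_subtopology: "paths (subtopology Z S) = {f \<in> paths Z. f ` {0..1} \<subseteq> S}"
  by (auto simp: paths_def continuous_map_in_subtopology image_subset_iff)

text \<open>
  The condition \<open>f ` K \<subseteq> U\<close>, on a path that stays in \<open>S\<close>, is the condition
  \<open>f ` K \<subseteq> U \<inter> S\<close>, so subbasic open sets pull back to subbasic open sets.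
\<close>

lemma continuous_map_path_space_subtopology:
  "continuous_map (path_space (subtopology Z S)) (path_space Z) (\<lambda>f. f)"
proof -
  let ?S = "subtopology Z S"
  have sub: "paths ?S \<subseteq> paths Z"
    by (auto simp: paths_subtopology)
  show ?thesis
    unfolding path_space_def[of Z]
  proof (rule continuous_on_generated_topo)
    fix W assume "W \<in> {{f \<in> paths Z. f ` K \<subseteq> U} | K U. compactin unit_interval K \<and> openin Z U}"
    then obtain K U where W: "W = {f \<in> paths Z. f ` K \<subseteq> U}"
      and K: "compactin unit_interval K" and U: "openin Z U"
      by blast
    have "K \<subseteq> {0..1}"
      using compactin_subset_topspace[OF K] by simp
    then have "(\<lambda>f. f) -` W \<inter> topspace (path_space ?S) = {f \<in> paths ?S. f ` K \<subseteq> U \<inter> S}"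
      by (auto simp: W topspace_path_space paths_subtopology)
    moreover have "openin ?S (U \<inter> S)"
      using U by (auto simp: openin_subtopology)
    then have "openin (path_space ?S) {f \<in> paths ?S. f ` K \<subseteq> U \<inter> S}"
      unfolding path_space_def using K by (intro topology_generated_by_Basis) blast
    ultimately show "openin (path_space ?S) ((\<lambda>f. f) -` W \<inter> topspace (path_space ?S))"
      by simp
  next
    have "\<Union> {{f \<in> paths Z. f ` K \<subseteq> U} | K U. compactin unit_interval K \<and> openin Z U} = paths Z"
      using topspace_path_space[of Z]
      by (simp only: path_space_def topology_generated_by_topspace)
    then show "(\<lambda>f. f) ` topspace (path_space ?S) \<subseteq>
        \<Union> {{f \<in> paths Z. f ` K \<subseteq> U} | K U. compactin unit_interval K \<and> openin Z U}"
      using sub by (auto simp: topspace_path_space)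
  qed
qed

lemma resolvable_mono:
  assumes "k \<le> n" and "resolvable k X f"
  shows "resolvable n X f"
  using assms(2) fin_prob_mono[OF assms(1), of "paths (mtopology_of X)"]
  unfolding resolvable_def fin_prob_space_eq_subtopology[OF assms(1)] paths_subtopology
  by blast

lemma continuous_map_resolvable_path_space_mono:
  assumes "k \<le> n"
  shows "continuous_map (resolvable_path_space k X) (resolvable_path_space n X) (\<lambda>f. f)"
proof -
  have "continuous_map (path_space (fin_prob_space k X)) (path_space (fin_prob_space n X)) (\<lambda>f. f)"
    unfolding fin_prob_space_eq_subtopology[OF assms]
    by (rule continuous_map_path_space_subtopology)
  then show ?thesis
    unfolding resolvable_path_space_def
    by (auto simp: continuous_map_in_subtopology continuous_map_from_subtopology
        resolvable_mono[OF assms])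
qed

text \<open>
  The universal property of the pullback, applied to the identity of \<open>A\<close>: a section is the
  graph of a lift of \<open>f\<close> through \<open>g\<close>.
\<close>

lemma section_fibre_product_iff_lift:
  "(\<exists>\<sigma>. continuous_map A (fibre_product A B f g) \<sigma> \<and> (\<forall>a \<in> topspace A. fst (\<sigma> a) = a)) \<longleftrightarrow>
   (\<exists>s. continuous_map A B s \<and> (\<forall>a \<in> topspace A. g (s a) = f a))"
proof
  assume "\<exists>\<sigma>. continuous_map A (fibre_product A B f g) \<sigma> \<and> (\<forall>a \<in> topspace A. fst (\<sigma> a) = a)"
  then obtain \<sigma> where \<sigma>: "continuous_map A (fibre_product A B f g) \<sigma>"
    and sect: "\<And>a. a \<in> topspace A \<Longrightarrow> fst (\<sigma> a) = a"
    by blast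
  have cont: "continuous_map A (prod_topology A B) \<sigma>"
    and sub: "\<sigma> \<in> topspace A \<rightarrow> {(a, b). f a = g b}"
    using \<sigma> by (simp_all add: fibre_product_def continuous_map_in_subtopology image_subset_iff_funcset)
  have pull: "f (fst (\<sigma> a)) = g (snd (\<sigma> a))" if "a \<in> topspace A" for a
    using funcset_mem[OF sub that] by (simp add: case_prod_beta)
  have "continuous_map A B (snd \<circ> \<sigma>)"
    using cont unfolding continuous_map_pairwise by blast
  moreover have "g ((snd \<circ> \<sigma>) a) = f a" if "a \<in> topspace A" for a
    using pull[OF that] sect[OF that] by simp
  ultimately show "\<exists>s. continuous_map A B s \<and> (\<forall>a \<in> topspace A. g (s a) = f a)"
    by blast
next
  assume "\<exists>s. continuous_map A B s \<and> (\<forall>a \<in> topspace A. g (s a) = f a)"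
  then obtain s where s: "continuous_map A B s" "\<And>a. a \<in> topspace A \<Longrightarrow> g (s a) = f a"
    by blast
  have "continuous_map A (fibre_product A B f g) (\<lambda>a. (a, s a))"
    using s by (auto simp: fibre_product_def continuous_map_in_subtopology
        continuous_map_pairwise o_def)
  then show "\<exists>\<sigma>. continuous_map A (fibre_product A B f g) \<sigma> \<and> (\<forall>a \<in> topspace A. fst (\<sigma> a) = a)"
    by (intro exI[of _ "\<lambda>a. (a, s a)"]) simp
qed

lemma eval_map_eq_dirac_map_iff:
  "eval_map m \<phi> = dirac_map m x \<longleftrightarrow> (\<forall>i \<in> {1..m}. \<phi> (time_point m i) = return_pmf (x i))"
  unfolding eval_map_def dirac_map_def
  by (auto simp: fun_eq_iff restrict_def)

theorem proposition6p1:
  fixes X :: "'a metric" and n m :: nat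
  assumes "path_connected_space (mtopology_of X)"
    and "ANR_space (mtopology_of X)"
    and "n \<ge> 1" and "m \<ge> 2"
  shows "iTC m X < enat n \<longleftrightarrow>
    (\<exists>\<sigma>. continuous_map (topology_power (mtopology_of X) m) (U_space n m X) \<sigma> \<and>
         (\<forall>x \<in> topspace (topology_power (mtopology_of X) m). q_map (\<sigma> x) = x))"
proof -
  let ?Xm = "topology_power (mtopology_of X) m"
  define lift where "lift k s \<longleftrightarrow> continuous_map ?Xm (resolvable_path_space k X) s \<and>
      (\<forall>x \<in> topspace ?Xm. eval_map m (s x) = dirac_map m x)" for k s
  have mono: "lift n s" if "lift k s" "k \<le> n" for k s
    using that(1) continuous_map_compose[OF _ continuous_map_resolvable_path_space_mono[OF that(2)],
        of ?Xm X s]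
    by (simp add: lift_def o_def)
  have iTC: "iTC m X = Inf {enat k | k. \<exists>s. lift (k + 1) s}"
    by (simp only: iTC_def lift_def eval_map_eq_dirac_map_iff)
  have "iTC m X < enat n \<longleftrightarrow> (\<exists>k<n. \<exists>s. lift (k + 1) s)"
    unfolding iTC Inf_less_iff by (auto simp: setcompr_eq_image)
  also have "\<dots> \<longleftrightarrow> (\<exists>s. lift n s)"
  proof
    assume "\<exists>k<n. \<exists>s. lift (k + 1) s"
    then show "\<exists>s. lift n s"
      using mono by (metis Suc_eq_plus1 Suc_leI)
  next
    assume "\<exists>s. lift n s"
    then show "\<exists>k<n. \<exists>s. lift (k + 1) s"
      using \<open>n \<ge> 1\<close> by (intro exI[of _ "n - 1"]) simp
  qed
  also have "\<dots> \<longleftrightarrow>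
      (\<exists>\<sigma>. continuous_map ?Xm (U_space n m X) \<sigma> \<and> (\<forall>x \<in> topspace ?Xm. q_map (\<sigma> x) = x))"
    unfolding lift_def U_space_def q_map_def section_fibre_product_iff_lift ..
  finally show ?thesis .
qed

end
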